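(* Let $F=(f_1,\ldots,f_m)^\top:\mathbb{R}^n\to\mathbb{R}^m$ be continuously differentiable, let $s\in\mathbb{N}$ with $1\le s<n$, and let $\Omega=\{x\in\mathbb{R}^n\mid \|x\|_0\le s\}$. Let $L>0$ and let $\bar x\in\Omega$ be an $L$-stationary point for the problem $\min_{x\in\Omega}F(x)$. Then $\bar x$ satisfies the Multi-Objective Lu-Zhang first-order optimality conditions (MOLZ conditions) for this problem.
   Context: $\|x\|_0$ denotes the number of nonzero components of $x$, and $\|\cdot\|$ is the Euclidean norm. $L$-stationarity: for $L>0$ and $\bar x\in\Omega$ let $\mathcal{D}_L(\bar x)=\{v\in\mathbb{R}^n\mid \bar x+v\in\Omega\}$ and $$\theta_L(\bar x)=\min_{d\in\mathcal{D}_L(\bar x)}\ \max_{j=1,\ldots,m}\nabla f_j(\bar x)^\top d+\frac{L}{2}\|d\|^2 .$$ The point $\bar x\in\Omega$ is $L$-stationary if $\theta_L(\bar x)=0$. MOLZ conditions: a super support set of $\bar x\in\Omega$ is an index set $J\subseteq\{1,\ldots,n\}$ with $\{i\mid \bar x_i\ne0\}\subseteq J$ and $|J|=s$; $\mathcal{J}(\bar x)$ is the set of all super support sets of $\bar x$. With $\bar J=\{1,\ldots,n\}\setminus J$ and $d_{\bar J}$ the subvector of $d$ indexed by $\bar J$, the point $\bar x\in\Omega$ satisfies the MOLZ conditions if there exists $J\in\mathcal{J}(\bar x)$ such that $$\theta_J(\bar x)=\min\Big\{\max_{j=1,\ldots,m}\nabla f_j(\bar x)^\top d+\tfrac12\|d\|^2\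 \Big|\ d\in\mathbb{R}^n,\ d_{\bar J}=0\Big\}=0 .$$ *)

theory Defs
  imports "HOL-Analysis.Analysis"
begin

definition continuously_differentiable :: "(real^'n \<Rightarrow> real^'m) \<Rightarrow> bool" where
  "continuously_differentiable F \<longleftrightarrow>
     (\<exists>F' :: real^'n \<Rightarrow> (real^'n) \<Rightarrow>\<^sub>L (real^'m).
        (\<forall>x. (F has_derivative blinfun_apply (F' x)) (at x)) \<and> continuous_on UNIV F')"

definition grad :: "(real^'n \<Rightarrow> real) \<Rightarrow> real^'n \<Rightarrow> real^'n" where
  "grad f x = (THE g. GDERIV f x :> g)"

definition norm0 :: "real^'n \<Rightarrow> nat" where
  "norm0 x = card {i. x $ i \<noteq> 0}"

definition sparse_set :: "nat \<Rightarrow> (real^'n) set" where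
  "sparse_set s = {x. norm0 x \<le> s}"

definition max_slope :: "(real^'n \<Rightarrow> real^'m) \<Rightarrow> real^'n \<Rightarrow> real^'n \<Rightarrow> real" where
  "max_slope F x d = Max (range (\<lambda>j. grad (\<lambda>y. F y $ j) x \<bullet> d))"

definition D_L :: "nat \<Rightarrow> real^'n \<Rightarrow> (real^'n) set" where
  "D_L s x = {v. x + v \<in> sparse_set s}"

text \<open>On \<^typ>\<open>real\<close>, \<^const>\<open>Least\<close> denotes the attained minimum. The lemmas at the end of
  this theory show that the minima below exist, so that these values are determined.\<close>

definition theta_L :: "(real^'n \<Rightarrow> real^'m) \<Rightarrow> nat \<Rightarrow> real \<Rightarrow> real^'n \<Rightarrow> real" where
  "theta_L F s L x = (LEAST t. t \<in> (\<lambda>d. max_slope F x d + L / 2 * (norm d)\<^sup>2) ` D_L s x)"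

definition L_stationary :: "(real^'n \<Rightarrow> real^'m) \<Rightarrow> nat \<Rightarrow> real \<Rightarrow> real^'n \<Rightarrow> bool" where
  "L_stationary F s L x \<longleftrightarrow> x \<in> sparse_set s \<and> theta_L F s L x = 0"

definition super_support_sets :: "nat \<Rightarrow> real^'n \<Rightarrow> 'n set set" where
  "super_support_sets s x = {J. {i. x $ i \<noteq> 0} \<subseteq> J \<and> card J = s}"

definition theta_J :: "(real^'n \<Rightarrow> real^'m) \<Rightarrow> 'n set \<Rightarrow> real^'n \<Rightarrow> real" where
  "theta_J F J x =
     (LEAST t. t \<in> (\<lambda>d. max_slope F x d + 1 / 2 * (norm d)\<^sup>2) ` {d. \<forall>i\<in>-J. d $ i = 0})"

definition MOLZ :: "(real^'n \<Rightarrow> real^'m) \<Rightarrow> nat \<Rightarrow> real^'n \<Rightarrow> bool" where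
  "MOLZ F s x \<longleftrightarrow>
     x \<in> sparse_set s \<and> (\<exists>J\<in>super_support_sets s x. theta_J F J x = 0)"

lemma grad_eq:
  assumes "GDERIV f x :> g"
  shows "grad f x = g"
proof -
  have uniq: "h = g" if "GDERIV f x :> h" for h
  proof -
    have "(\<lambda>v. v \<bullet> h) = (\<lambda>v. v \<bullet> g)"
      using that assms unfolding gderiv_def by (rule has_derivative_unique)
    then have "\<forall>v. v \<bullet> h = v \<bullet> g" by (simp add: fun_eq_iff)
    then show ?thesis by (simp add: vector_eq_ldot)
  qed
  show ?thesis unfolding grad_def by (rule the_equality) (rule assms, rule uniq)
qed

lemma GDERIV_grad_component:
  assumes "continuously_differentiable F"
  shows "GDERIV (\<lambda>y. F y $ j) x :> grad (\<lambda>y. F y $ j) x"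
proof -
  obtain F' where "(F has_derivative blinfun_apply (F' x)) (at x)"
    using assms unfolding continuously_differentiable_def by blast
  then have D: "((\<lambda>y. F y $ j) has_derivative (\<lambda>h. blinfun_apply (F' x) h $ j)) (at x)"
    by (rule bounded_linear.has_derivative[OF bounded_linear_vec_nth])
  have "\<exists>g. (\<lambda>h. blinfun_apply (F' x) h $ j) = (\<lambda>h. h \<bullet> g)"
  proof (intro exI ext)
    fix h
    let ?l = "\<lambda>h. blinfun_apply (F' x) h $ j"
    have "linear ?l" using D has_derivative_linear by blast
    then show "?l h = h \<bullet> adjoint ?l 1"
      using adjoint_works[of ?l h 1] by simp
  qed
  then obtain g where "GDERIV (\<lambda>y. F y $ j) x :> g"
    using D unfolding gderiv_def by auto
  then show ?thesis by (simp add: grad_eq)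
qed

lemma closed_coord_subspace: "closed {d :: real^'n. \<forall>i\<in>K. d $ i = 0}"
proof -
  have "{d :: real^'n. \<forall>i\<in>K. d $ i = 0} = (\<Inter>i\<in>K. {d. d $ i = 0})" by auto
  moreover have "closed {d :: real^'n. d $ i = 0}" for i
    by (rule closed_Collect_eq) (auto intro: continuous_intros)
  ultimately show ?thesis by (simp only:) (rule closed_INT, blast)
qed

lemma closed_sparse_set: "closed (sparse_set s :: (real^'n) set)"
proof -
  have "sparse_set s = (\<Union>J\<in>{J :: 'n set. card J \<le> s}. {x :: real^'n. \<forall>i\<in>-J. x $ i = 0})"
  proof (intro set_eqI iffI)
    fix x :: "real^'n"
    assume "x \<in> sparse_set s"
    then show "x \<in> (\<Union>J\<in>{J. card J \<le> s}. {x. \<forall>i\<in>-J. x $ i = 0})"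
      by (auto simp: sparse_set_def norm0_def intro!: exI[of _ "{i. x $ i \<noteq> 0}"])
  next
    fix x :: "real^'n"
    assume "x \<in> (\<Union>J\<in>{J. card J \<le> s}. {x. \<forall>i\<in>-J. x $ i = 0})"
    then obtain J where J: "card J \<le> s" "\<forall>i\<in>-J. x $ i = 0" by blast
    then have "{i. x $ i \<noteq> 0} \<subseteq> J" by blast
    then have "card {i. x $ i \<noteq> 0} \<le> card J" by (simp add: card_mono)
    with J(1) show "x \<in> sparse_set s" by (simp add: sparse_set_def norm0_def)
  qed
  then show ?thesis by (auto intro!: closed_UN closed_coord_subspace)
qed

lemma continuous_max_slope: "continuous_on A (max_slope F x)"
proof -
  have "continuous_on A (\<lambda>d. Max ((\<lambda>j. g j \<bullet> d) ` I))"
    if "finite I" "I \<noteq> {}" for g :: "'b \<Rightarrow> real^'a" and I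
    using that
  proof (induction I rule: finite_ne_induct)
    case (insert j I)
    then have "Max ((\<lambda>j. g j \<bullet> d) ` insert j I) = max (g j \<bullet> d) (Max ((\<lambda>j. g j \<bullet> d) ` I))" for d
      by simp
    with insert.IH show ?case by (auto intro!: continuous_intros)
  qed (auto intro!: continuous_intros)
  then show ?thesis unfolding max_slope_def by simp
qed

lemma model_attains_min:
  fixes F :: "real^'n \<Rightarrow> real^'m"
  assumes L: "L > 0" and S: "closed S" "0 \<in> S"
  shows "\<exists>d\<in>S. \<forall>e\<in>S. max_slope F x d + L / 2 * (norm d)\<^sup>2 \<le> max_slope F x e + L / 2 * (norm e)\<^sup>2"
proof -
  let ?q = "\<lambda>d. max_slope F x d + L / 2 * (norm d)\<^sup>2"
  obtain j :: 'm where True by blast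
  define g where "g = grad (\<lambda>y. F y $ j) x"
  define r where "r = 2 * norm g / L"
  have q0: "?q 0 = 0" by (simp add: max_slope_def)
  have out: "?q e \<ge> 0" if "norm e \<ge> r" for e
  proof -
    have "max_slope F x e \<ge> g \<bullet> e"
      unfolding max_slope_def g_def by (intro Max_ge) auto
    moreover have "g \<bullet> e \<ge> - (norm g * norm e)"
      using Cauchy_Schwarz_ineq2[of g e] by linarith
    moreover have "norm g * norm e \<le> L / 2 * norm e * norm e"
      using that L by (intro mult_right_mono) (auto simp: r_def field_simps)
    ultimately show ?thesis by (simp add: power2_eq_square)
  qed
  have r: "r \<ge> 0" using L by (simp add: r_def)
  have "\<exists>d\<in>S \<inter> cball 0 r. \<forall>e\<in>S \<inter> cball 0 r. ?q d \<le> ?q e"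
    using S r by (intro continuous_attains_inf closed_Int_compact continuous_intros
        continuous_max_slope) auto
  then obtain d where d: "d \<in> S" "\<And>e. e \<in> S \<Longrightarrow> norm e \<le> r \<Longrightarrow> ?q d \<le> ?q e"
    by auto
  have le0: "?q d \<le> 0" using d(2)[of 0] S r q0 by simp
  have "\<forall>e\<in>S. ?q d \<le> ?q e" 
  proof
    fix e assume "e \<in> S"
    show "?q d \<le> ?q e"
    proof (cases "norm e \<le> r")
      case True
      then show ?thesis using d(2) \<open>e \<in> S\<close> by blast
    next
      case False
      then have "?q e \<ge> 0" by (intro out) simp
      with le0 show ?thesis by linarith
    qed
  qed
  with d(1) show ?thesis by blast
qed

lemma theta_L_attained:
  assumes "L > 0" "x \<in> sparse_set s"
  shows "\<exists>d\<in>D_L s x. theta_L F s L x = max_slope F x d + L / 2 * (norm d)\<^sup>2 \<and>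
           (\<forall>e\<in>D_L s x. theta_L F s L x \<le> max_slope F x e + L / 2 * (norm e)\<^sup>2)"
proof -
  have "D_L s x = (\<lambda>v. x + v) -` sparse_set s" by (auto simp: D_L_def)
  then have "closed (D_L s x)"
    by (auto intro!: closed_vimage closed_sparse_set continuous_intros)
  moreover have "0 \<in> D_L s x" using assms(2) by (simp add: D_L_def)
  ultimately obtain d where d: "d \<in> D_L s x"
    "\<forall>e\<in>D_L s x. max_slope F x d + L / 2 * (norm d)\<^sup>2 \<le> max_slope F x e + L / 2 * (norm e)\<^sup>2"
    using model_attains_min[OF assms(1), of "D_L s x" F x] by blast
  then have "theta_L F s L x = max_slope F x d + L / 2 * (norm d)\<^sup>2"
    unfolding theta_L_def by (intro Least_equality) auto
  with d show ?thesis by (intro bexI[of _ d]) auto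
qed

lemma theta_J_attained:
  fixes x :: "real^'n"
  shows "\<exists>d\<in>{d. \<forall>i\<in>-J. d $ i = 0}. theta_J F J x = max_slope F x d + 1 / 2 * (norm d)\<^sup>2 \<and>
     (\<forall>e\<in>{d. \<forall>i\<in>-J. d $ i = 0}. theta_J F J x \<le> max_slope F x e + 1 / 2 * (norm e)\<^sup>2)"
proof -
  define S where "S = {d :: real^'n. \<forall>i\<in>-J. d $ i = 0}"
  have "closed S" unfolding S_def by (rule closed_coord_subspace)
  moreover have "0 \<in> S" by (simp add: S_def)
  ultimately obtain d where d: "d \<in> S"
    "\<forall>e\<in>S. max_slope F x d + 1 / 2 * (norm d)\<^sup>2 \<le> max_slope F x e + 1 / 2 * (norm e)\<^sup>2"
    using model_attains_min[OF zero_less_one, of S F x] by blast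
  then have "theta_J F J x = max_slope F x d + 1 / 2 * (norm d)\<^sup>2"
    unfolding theta_J_def S_def[symmetric] by (intro Least_equality) auto
  with d show ?thesis unfolding S_def[symmetric] by (intro bexI[of _ d]) auto
qed

end

theory Submission
  imports Defs
begin

text \<open>Fix a super support set \<open>J\<close>. If \<open>d\<close> vanishes off \<open>J\<close>, then \<open>d / L\<close> is a feasible
  displacement, and \<open>L\<close> times the \<open>L\<close>-model at \<open>d / L\<close> equals the MOLZ model at \<open>d\<close>.
  So nonnegativity of the former carries over to the latter.\<close>

lemma max_slope_0: "max_slope F x 0 = 0"
  by (simp add: max_slope_def)

text \<open>Multiplication by a nonnegative constant is monotone, so it commutes with the maximum of
  a finite set.\<close>

lemma max_slope_scaleR:
  fixes F :: "real^'n \<Rightarrow> real^'m"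
  assumes "c \<ge> 0"
  shows "max_slope F x (c *\<^sub>R d) = c * max_slope F x d"
proof -
  let ?A = "range (\<lambda>j. grad (\<lambda>y. F y $ j) x \<bullet> d)"
  have "c * Max ?A = Max ((*) c ` ?A)"
    using assms by (intro mono_Max_commute) (auto simp: mono_def mult_left_mono)
  then show ?thesis by (simp add: max_slope_def image_image)
qed

text \<open>The support has at most \<open>s\<close> elements and the whole index type at least
  \<open>s\<close>, so some set in between has exactly \<open>s\<close>.\<close>

lemma super_support_sets_nonempty:
  fixes x :: "real^'n"
  assumes "x \<in> sparse_set s" "s \<le> CARD('n)"
  obtains J where "J \<in> super_support_sets s x"
  using exists_subset_between[of "{i. x $ i \<noteq> 0}" s UNIV] assms
  by (auto simp: sparse_set_def norm0_def super_support_sets_def)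

text \<open>Both \<open>x\<close> and \<open>d\<close> are supported in \<open>J\<close>, hence so
  is their sum, and \<open>J\<close> has only \<open>s\<close> elements.\<close>

lemma super_support_set_direction_in_D_L:
  assumes "J \<in> super_support_sets s x" "\<forall>i\<in>-J. d $ i = 0"
  shows "d \<in> D_L s x"
proof -
  have "{i. (x + d) $ i \<noteq> 0} \<subseteq> J"
    using assms by (auto simp: super_support_sets_def)
  then have "card {i. (x + d) $ i \<noteq> 0} \<le> card J" by (simp add: card_mono)
  then show ?thesis
    using assms(1) by (simp add: D_L_def sparse_set_def norm0_def super_support_sets_def)
qed

lemma L_stationary_imp_theta_J_eq_0:
  fixes x :: "real^'n"
  assumes "L > 0" "L_stationary F s L x" "J \<in> super_support_sets s x"
  shows "theta_J F J x = 0"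
proof -
  \<comment> \<open>The zero direction is feasible with model value 0, which bounds the minimum from
    above.\<close>
  have "0 \<in> {d :: real^'n. \<forall>i\<in>-J. d $ i = 0}" by simp
  then have "theta_J F J x \<le> max_slope F x 0 + 1 / 2 * (norm (0 :: real^'n))\<^sup>2"
    using theta_J_attained[of J F x] by blast
  then have "theta_J F J x \<le> 0" by (simp add: max_slope_0)
  moreover have "max_slope F x d + 1 / 2 * (norm d)\<^sup>2 \<ge> 0" if "\<forall>i\<in>-J. d $ i = 0" for d
  proof -
    have "(1 / L) *\<^sub>R d \<in> D_L s x"
      using assms(3) that by (intro super_support_set_direction_in_D_L) auto
    \<comment> \<open>By stationarity the minimum of the \<open>L\<close>-model over
      \<open>D_L s x\<close> is 0, so no feasible displacement has a negative value.\<close>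
    then have "0 \<le> max_slope F x ((1 / L) *\<^sub>R d) + L / 2 * (norm ((1 / L) *\<^sub>R d))\<^sup>2"
      using theta_L_attained[of L x s F] assms(1,2) by (auto simp: L_stationary_def)
    also have "\<dots> = (1 / L) * (max_slope F x d + 1 / 2 * (norm d)\<^sup>2)"
      using assms(1) max_slope_scaleR[of "1 / L" F x d]
      by (simp add: field_simps power2_eq_square)
    finally show ?thesis using assms(1) by (simp add: zero_le_divide_iff)
  qed
  \<comment> \<open>The minimum is attained, so it is itself one of the model values just shown to
    be nonnegative.\<close>
  then have "theta_J F J x \<ge> 0"
    using theta_J_attained[of J F x] by auto
  ultimately show ?thesis by simp
qed

theorem corollary1:
  fixes F :: "real^'n \<Rightarrow> real^'m" and s :: nat and L :: real and xbar :: "real^'n"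
  assumes "continuously_differentiable F"
    and "1 \<le> s" and "s < CARD('n)"
    and "L > 0"
    and "xbar \<in> sparse_set s"
    and "L_stationary F s L xbar"
  shows "MOLZ F s xbar"
proof -
  obtain J where J: "J \<in> super_support_sets s xbar"
    using super_support_sets_nonempty[OF assms(5) less_imp_le[OF assms(3)]] .
  have "theta_J F J xbar = 0"
    using assms(4,6) J by (rule L_stationary_imp_theta_J_eq_0)
  then show ?thesis
    using assms(5) J by (auto simp: MOLZ_def)
qed

end
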